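(* Let $R$ be a finite Frobenius ring with unity (not assumed commutative), let $n$ be a positive integer, and let $C$ and $D$ be two linear codes in $R^n$ (i.e. right $R$-submodules of $R^n$). Then the pair $(C,D)$ is LCP if and only if $D$ is a complement of $C$ in $R^n$ such that $C\oplus D$ is closed in $R^n$.
   Context: A finite ring $R$ is Frobenius if it is right and left self-injective and $R/J(R)\cong \mathrm{Soc}(R)$ as right $R$-modules, where $J(R)$ is the Jacobson radical. A linear code of length $n$ over $R$ is a right $R$-submodule of $R^n$. The pair $(C,D)$ is LCP (a linear complementary pair) if $C\oplus D=R^n$, i.e. $C+D=R^n$ and $C\cap D=\{0\}$. For right $R$-submodules $A,B$ of $R^n$, $B$ is a complement (submodule) of $A$ in $R^n$ if $B$ is maximal among right $R$-submodules of $R^n$ with respect to $A\cap B=\{0\}$. A right $R$-submodule of $R^n$ is closed in $R^n$ if it is the complement of some right $R$-submodule of $R^n$. Writing $C\oplus D$ means the internal direct sum, so it includes the assertion $C\cap D=\{0\}$. *)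

theory Defs
  imports "HOL-Algebra.AbelCoset" "HOL-Algebra.Generated_Groups"
begin

text \<open>
  The module locale of HOL-Algebra assumes a commutative ring, so right modules over an arbitrary
  ring with unity are introduced here in the same record style. As there, the ring record is
  extended only to inherit the additive structure: the fields \<open>mult\<close> and \<open>one\<close> of a module
  are irrelevant.
\<close>

record ('a, 'm) rmodule = "'m ring" +
  rsmult :: "['m, 'a] \<Rightarrow> 'm" (infixl \<open>\<cdot>\<index>\<close> 70)

locale right_module = R?: ring R + M?: abelian_group M
  for R :: "('a, 'r) ring_scheme" (structure)
    and M :: "('a, 'm, 'x) rmodule_scheme" (structure) +
  assumes rsmult_closed:
      "\<lbrakk>x \<in> carrier M; r \<in> carrier R\<rbrakk> \<Longrightarrow> x \<cdot>\<^bsub>M\<^esub> r \<in> carrier M"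
    and rsmult_add_left:
      "\<lbrakk>x \<in> carrier M; y \<in> carrier M; r \<in> carrier R\<rbrakk> \<Longrightarrow>
        (x \<oplus>\<^bsub>M\<^esub> y) \<cdot>\<^bsub>M\<^esub> r = x \<cdot>\<^bsub>M\<^esub> r \<oplus>\<^bsub>M\<^esub> y \<cdot>\<^bsub>M\<^esub> r"
    and rsmult_add_right:
      "\<lbrakk>x \<in> carrier M; r \<in> carrier R; s \<in> carrier R\<rbrakk> \<Longrightarrow>
        x \<cdot>\<^bsub>M\<^esub> (r \<oplus>\<^bsub>R\<^esub> s) = x \<cdot>\<^bsub>M\<^esub> r \<oplus>\<^bsub>M\<^esub> x \<cdot>\<^bsub>M\<^esub> s"
    and rsmult_assoc:
      "\<lbrakk>x \<in> carrier M; r \<in> carrier R; s \<in> carrier R\<rbrakk> \<Longrightarrow>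
        x \<cdot>\<^bsub>M\<^esub> (r \<otimes>\<^bsub>R\<^esub> s) = (x \<cdot>\<^bsub>M\<^esub> r) \<cdot>\<^bsub>M\<^esub> s"
    and rsmult_one: "x \<in> carrier M \<Longrightarrow> x \<cdot>\<^bsub>M\<^esub> \<one>\<^bsub>R\<^esub> = x"

definition right_submodule ::
  "('a, 'r) ring_scheme \<Rightarrow> ('a, 'm, 'x) rmodule_scheme \<Rightarrow> 'm set \<Rightarrow> bool" where
  "right_submodule R M A \<longleftrightarrow>
     subgroup A (add_monoid M) \<and> (\<forall>x\<in>A. \<forall>r\<in>carrier R. x \<cdot>\<^bsub>M\<^esub> r \<in> A)"

definition rmod_hom ::
  "('a, 'r) ring_scheme \<Rightarrow> ('a, 'm, 'x) rmodule_scheme \<Rightarrow> ('a, 'n, 'y) rmodule_scheme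
     \<Rightarrow> ('m \<Rightarrow> 'n) set" where
  "rmod_hom R M N =
     {f \<in> hom (add_monoid M) (add_monoid N).
        \<forall>x\<in>carrier M. \<forall>r\<in>carrier R. f (x \<cdot>\<^bsub>M\<^esub> r) = f x \<cdot>\<^bsub>N\<^esub> r}"

definition rmod_isomorphic ::
  "('a, 'r) ring_scheme \<Rightarrow> ('a, 'm, 'x) rmodule_scheme \<Rightarrow> ('a, 'n, 'y) rmodule_scheme
     \<Rightarrow> bool" where
  "rmod_isomorphic R M N \<longleftrightarrow> (\<exists>f\<in>rmod_hom R M N. bij_betw f (carrier M) (carrier N))"

definition quotient_rmod ::
  "('a, 'm, 'x) rmodule_scheme \<Rightarrow> 'm set \<Rightarrow> ('a, 'm set) rmodule" where
  "quotient_rmod M N =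
     \<lparr>carrier = a_rcosets\<^bsub>M\<^esub> N, mult = undefined, one = undefined,
      zero = N, add = (\<lambda>X Y. X <+>\<^bsub>M\<^esub> Y),
      rsmult = (\<lambda>X r. \<Union>x\<in>X. N +>\<^bsub>M\<^esub> (x \<cdot>\<^bsub>M\<^esub> r))\<rparr>"

definition regular_rmod :: "('a, 'r) ring_scheme \<Rightarrow> ('a, 'a) rmodule" where
  "regular_rmod R =
     \<lparr>carrier = carrier R, mult = mult R, one = one R, zero = zero R, add = add R,
      rsmult = mult R\<rparr>"

text \<open>
  \<open>R\<^sup>n\<close>: functions on \<open>{..<n}\<close> (with value \<open>undefined\<close> outside) with pointwise operations.
\<close>

definition power_rmod :: "('a, 'r) ring_scheme \<Rightarrow> nat \<Rightarrow> ('a, nat \<Rightarrow> 'a) rmodule" where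
  "power_rmod R n =
     \<lparr>carrier = {..<n} \<rightarrow>\<^sub>E carrier R,
      mult = (\<lambda>x y. \<lambda>i\<in>{..<n}. x i \<otimes>\<^bsub>R\<^esub> y i), one = (\<lambda>i\<in>{..<n}. \<one>\<^bsub>R\<^esub>),
      zero = (\<lambda>i\<in>{..<n}. \<zero>\<^bsub>R\<^esub>), add = (\<lambda>x y. \<lambda>i\<in>{..<n}. x i \<oplus>\<^bsub>R\<^esub> y i),
      rsmult = (\<lambda>x r. \<lambda>i\<in>{..<n}. x i \<otimes>\<^bsub>R\<^esub> r)\<rparr>"

definition opposite_ring :: "('a, 'r) ring_scheme \<Rightarrow> ('a, 'r) ring_scheme" where
  "opposite_ring R = R\<lparr>mult := (\<lambda>x y. y \<otimes>\<^bsub>R\<^esub> x)\<rparr>"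

text \<open>
  A HOL definition cannot quantify over types, so injectivity is relative to a type \<open>'c\<close> in which
  the carriers of the test modules live.
\<close>

definition injective_rmod ::
  "'c itself \<Rightarrow> ('a, 'r) ring_scheme \<Rightarrow> ('a, 'e, 'x) rmodule_scheme \<Rightarrow> bool" where
  "injective_rmod TYPE('c) R E \<longleftrightarrow>
     right_module R E \<and>
     (\<forall>(A :: ('a, 'c) rmodule) (B :: ('a, 'c) rmodule) g f.
        right_module R A \<longrightarrow> right_module R B \<longrightarrow>
        g \<in> rmod_hom R A B \<longrightarrow> inj_on g (carrier A) \<longrightarrow> f \<in> rmod_hom R A E \<longrightarrow>
        (\<exists>h\<in>rmod_hom R B E. \<forall>x\<in>carrier A. h (g x) = f x))"

text \<open>
  The type \<open>(nat \<Rightarrow> 'a) set\<close> contains, up to isomorphism, every countably generated right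
  \<open>R\<close>-module (as a set of cosets in a countable direct sum of copies of \<open>R\<close>); in particular it
  contains \<open>R\<close> and its right ideals, so by Baer's criterion injectivity relative to this type is
  injectivity with respect to all right \<open>R\<close>-modules.
\<close>

definition right_self_injective :: "('a, 'r) ring_scheme \<Rightarrow> bool" where
  "right_self_injective R \<longleftrightarrow> injective_rmod TYPE((nat \<Rightarrow> 'a) set) R (regular_rmod R)"

text \<open>Left \<open>R\<close>-modules are right modules over the opposite ring.\<close>

definition left_self_injective :: "('a, 'r) ring_scheme \<Rightarrow> bool" where
  "left_self_injective R \<longleftrightarrow> right_self_injective (opposite_ring R)"

definition maximal_right_submodule ::
  "('a, 'r) ring_scheme \<Rightarrow> ('a, 'm, 'x) rmodule_scheme \<Rightarrow> 'm set \<Rightarrow> bool" where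
  "maximal_right_submodule R M A \<longleftrightarrow>
     right_submodule R M A \<and> A \<noteq> carrier M \<and>
     (\<forall>B. right_submodule R M B \<longrightarrow> A \<subseteq> B \<longrightarrow> B = A \<or> B = carrier M)"

definition simple_right_submodule ::
  "('a, 'r) ring_scheme \<Rightarrow> ('a, 'm, 'x) rmodule_scheme \<Rightarrow> 'm set \<Rightarrow> bool" where
  "simple_right_submodule R M A \<longleftrightarrow>
     right_submodule R M A \<and> A \<noteq> {\<zero>\<^bsub>M\<^esub>} \<and>
     (\<forall>B. right_submodule R M B \<longrightarrow> B \<subseteq> A \<longrightarrow> B = {\<zero>\<^bsub>M\<^esub>} \<or> B = A)"

text \<open>
  The intersection of the maximal right ideals; intersecting with the carrier matters only for
  the zero ring, which has no maximal right ideals.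
\<close>

definition jacobson_radical :: "('a, 'r) ring_scheme \<Rightarrow> 'a set" where
  "jacobson_radical R =
     carrier R \<inter> \<Inter>{I. maximal_right_submodule R (regular_rmod R) I}"

text \<open>
  The socle is the sum of the simple submodules, i.e. the additive subgroup generated by
  their union.
\<close>

definition socle :: "('a, 'r) ring_scheme \<Rightarrow> ('a, 'm, 'x) rmodule_scheme \<Rightarrow> 'm set" where
  "socle R M = generate (add_monoid M) (\<Union>{S. simple_right_submodule R M S})"

definition finite_frobenius_ring :: "('a, 'r) ring_scheme \<Rightarrow> bool" where
  "finite_frobenius_ring R \<longleftrightarrow>
     ring R \<and> finite (carrier R) \<and> right_self_injective R \<and> left_self_injective R \<and>
     rmod_isomorphic R
       (quotient_rmod (regular_rmod R) (jacobson_radical R))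
       ((regular_rmod R)\<lparr>carrier := socle R (regular_rmod R)\<rparr>)"

definition linear_code :: "('a, 'r) ring_scheme \<Rightarrow> nat \<Rightarrow> (nat \<Rightarrow> 'a) set \<Rightarrow> bool" where
  "linear_code R n C \<longleftrightarrow> right_submodule R (power_rmod R n) C"

definition internal_direct_sum ::
  "('a, 'm, 'x) rmodule_scheme \<Rightarrow> 'm set \<Rightarrow> 'm set \<Rightarrow> 'm set \<Rightarrow> bool" where
  "internal_direct_sum M A B S \<longleftrightarrow> A <+>\<^bsub>M\<^esub> B = S \<and> A \<inter> B = {\<zero>\<^bsub>M\<^esub>}"

definition LCP ::
  "('a, 'r) ring_scheme \<Rightarrow> nat \<Rightarrow> (nat \<Rightarrow> 'a) set \<Rightarrow> (nat \<Rightarrow> 'a) set \<Rightarrow> bool" where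
  "LCP R n C D \<longleftrightarrow>
     internal_direct_sum (power_rmod R n) C D (carrier (power_rmod R n))"

text \<open>\<open>complement_of R M A B\<close>: the submodule \<open>B\<close> is a complement of the submodule \<open>A\<close> in \<open>M\<close>.\<close>

definition complement_of ::
  "('a, 'r) ring_scheme \<Rightarrow> ('a, 'm, 'x) rmodule_scheme \<Rightarrow> 'm set \<Rightarrow> 'm set \<Rightarrow> bool" where
  "complement_of R M A B \<longleftrightarrow>
     right_submodule R M A \<and> right_submodule R M B \<and> A \<inter> B = {\<zero>\<^bsub>M\<^esub>} \<and>
     (\<forall>B'. right_submodule R M B' \<longrightarrow> A \<inter> B' = {\<zero>\<^bsub>M\<^esub>} \<longrightarrow> B \<subseteq> B' \<longrightarrow> B' = B)"

definition closed_submodule ::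
  "('a, 'r) ring_scheme \<Rightarrow> ('a, 'm, 'x) rmodule_scheme \<Rightarrow> 'm set \<Rightarrow> bool" where
  "closed_submodule R M A \<longleftrightarrow> (\<exists>B. right_submodule R M B \<and> complement_of R M B A)"

end

(* If D is a complement of C in a right module M, then C + D is essential: for a submodule B
   meeting C + D trivially, D + B still meets C trivially, so B lies in D by maximality and hence
   B = 0. If moreover C + D is itself a complement of some B, then B meets it trivially, so B = 0,
   and the only complement of 0 is M. *)
theory Submission
  imports Defs
begin

lemma right_module_power_rmod:
  assumes "ring R"
  shows "right_module R (power_rmod R n)"
proof -
  interpret R: ring R by fact
  have neg: "\<exists>y\<in>{..<n} \<rightarrow>\<^sub>E carrier R.
      (\<lambda>i\<in>{..<n}. x i \<oplus>\<^bsub>R\<^esub> y i) = (\<lambda>i\<in>{..<n}. \<zero>\<^bsub>R\<^esub>)" if "x \<in> {..<n} \<rightarrow>\<^sub>E carrier R" for x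
  proof
    show "(\<lambda>i\<in>{..<n}. \<ominus>\<^bsub>R\<^esub> x i) \<in> {..<n} \<rightarrow>\<^sub>E carrier R"
      using that by (simp add: PiE_iff)
    show "(\<lambda>i\<in>{..<n}. x i \<oplus>\<^bsub>R\<^esub> (\<lambda>i\<in>{..<n}. \<ominus>\<^bsub>R\<^esub> x i) i) = (\<lambda>i\<in>{..<n}. \<zero>\<^bsub>R\<^esub>)"
      using that by (simp add: PiE_iff R.r_neg cong: restrict_cong)
  qed
  \<comment> \<open>Elements of the carrier are \<open>undefined\<close> off the index set, so
    agreement at the indices below \<open>n\<close> already gives equality of functions. This
    settles the laws whose right-hand side is a bare vector: adding zero and scaling by one.\<close>
  have neutral: "(\<lambda>i\<in>{..<n}. f i) = x"
    if "x \<in> {..<n} \<rightarrow>\<^sub>E carrier R" "\<And>i. i < n \<Longrightarrow> f i = x i" for x f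
    using that by (simp add: PiE_iff extensional_restrict cong: restrict_cong)
  have "abelian_group (power_rmod R n)"
    by (rule abelian_groupI)
      (simp_all add: power_rmod_def PiE_iff R.a_ac neg neutral cong: restrict_cong)
  moreover have "right_module_axioms R (power_rmod R n)"
    by (rule right_module_axioms.intro)
      (simp_all add: power_rmod_def PiE_iff R.l_distr R.r_distr R.m_assoc
        neutral cong: restrict_cong)
  ultimately show ?thesis
    using assms by (simp add: right_module_def)
qed

context right_module
begin

text \<open>Additivity applied to 0 + 0 = 0 gives 0r + 0r = 0r, and cancellation leaves 0r = 0. This
  is what makes the zero subgroup a submodule.\<close>

lemma zero_rsmult:
  assumes "r \<in> carrier R"
  shows "\<zero>\<^bsub>M\<^esub> \<cdot>\<^bsub>M\<^esub> r = \<zero>\<^bsub>M\<^esub>"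
  using rsmult_add_left[of "\<zero>\<^bsub>M\<^esub>" "\<zero>\<^bsub>M\<^esub>" r] rsmult_closed[of "\<zero>\<^bsub>M\<^esub>" r] assms
  by (metis M.add.r_cancel_one' M.l_zero M.zero_closed)

lemma right_submodule_carrier: "right_submodule R M (carrier M)"
  using M.add.subgroup_self rsmult_closed by (auto simp: right_submodule_def)

lemma right_submodule_zero: "right_submodule R M {\<zero>\<^bsub>M\<^esub>}"
  using M.add.triv_subgroup zero_rsmult by (auto simp: right_submodule_def)

context
  fixes A
  assumes A: "right_submodule R M A"
begin

lemma right_submodule_subset: "A \<subseteq> carrier M"
  using A subgroup.subset[of A "add_monoid M"] by (simp add: right_submodule_def)

lemma right_submodule_zero_mem: "\<zero>\<^bsub>M\<^esub> \<in> A"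
  using A subgroup.one_closed[of A "add_monoid M"] by (simp add: right_submodule_def)

lemma right_submodule_minus:
  assumes "x \<in> A" "y \<in> A"
  shows "x \<ominus>\<^bsub>M\<^esub> y \<in> A"
  using A assms subgroup.m_closed[of A "add_monoid M"] subgroup.m_inv_closed[of A "add_monoid M"]
  by (simp add: right_submodule_def a_minus_def a_inv_def)

end

lemma mem_set_addI:
  assumes "x \<in> A" "y \<in> B"
  shows "x \<oplus>\<^bsub>M\<^esub> y \<in> A <+>\<^bsub>M\<^esub> B"
  using assms by (auto simp: set_add_def')

text \<open>Commutativity of addition makes the sum of two subgroups a subgroup; scalars act on the
  two parts of a + b separately.\<close>

lemma right_submodule_set_add:
  assumes A: "right_submodule R M A" and B: "right_submodule R M B"
  shows "right_submodule R M (A <+>\<^bsub>M\<^esub> B)"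
proof -
  have "subgroup (A <+>\<^bsub>M\<^esub> B) (add_monoid M)"
    using M.add.mult_subgroups A B by (simp add: right_submodule_def set_add_def)
  moreover have "x \<cdot>\<^bsub>M\<^esub> r \<in> A <+>\<^bsub>M\<^esub> B" if x: "x \<in> A <+>\<^bsub>M\<^esub> B" and r: "r \<in> carrier R" for x r
  proof -
    obtain a b where "a \<in> A" "b \<in> B" "x = a \<oplus>\<^bsub>M\<^esub> b"
      using x by (auto simp: set_add_def')
    then show ?thesis
      using A B r rsmult_add_left[of a b r] right_submodule_subset[OF A]
        right_submodule_subset[OF B] mem_set_addI[of "a \<cdot>\<^bsub>M\<^esub> r" A "b \<cdot>\<^bsub>M\<^esub> r" B]
      by (auto simp: right_submodule_def subset_iff)
  qed
  ultimately show ?thesis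
    by (simp add: right_submodule_def)
qed

lemma set_add_upper:
  assumes A: "right_submodule R M A" and B: "right_submodule R M B"
  shows "A \<subseteq> A <+>\<^bsub>M\<^esub> B" "B \<subseteq> A <+>\<^bsub>M\<^esub> B"
proof
  show "x \<in> A <+>\<^bsub>M\<^esub> B" if "x \<in> A" for x
    using mem_set_addI[OF that right_submodule_zero_mem[OF B]] right_submodule_subset[OF A] that
    by (simp add: subset_iff)
  show "B \<subseteq> A <+>\<^bsub>M\<^esub> B"
  proof
    show "x \<in> A <+>\<^bsub>M\<^esub> B" if "x \<in> B" for x
      using mem_set_addI[OF right_submodule_zero_mem[OF A] that] right_submodule_subset[OF B] that
      by (simp add: subset_iff)
  qed
qed

text \<open>Every submodule meets zero trivially, so the complements of zero are the maximal
  elements among all submodules. It is used in both directions of the equivalence: to see that the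
  whole module is closed, and to recognise a sum as the whole module.\<close>

lemma complement_of_zero_iff: "complement_of R M {\<zero>\<^bsub>M\<^esub>} S \<longleftrightarrow> S = carrier M"
proof
  assume "complement_of R M {\<zero>\<^bsub>M\<^esub>} S"
  then show "S = carrier M"
    using right_submodule_subset[of S] right_submodule_carrier by (auto simp: complement_of_def)
next
  assume "S = carrier M"
  then show "complement_of R M {\<zero>\<^bsub>M\<^esub>} S"
    using right_submodule_subset right_submodule_carrier right_submodule_zero
    by (simp add: complement_of_def subset_antisym)
qed

lemma complement_set_add_essential:
  assumes CD: "complement_of R M C D" and B: "right_submodule R M B"
    and disj: "B \<inter> (C <+>\<^bsub>M\<^esub> D) = {\<zero>\<^bsub>M\<^esub>}"
  shows "B = {\<zero>\<^bsub>M\<^esub>}"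
proof -
  have C: "right_submodule R M C" and D: "right_submodule R M D" and int: "C \<inter> D = {\<zero>\<^bsub>M\<^esub>}"
    using CD by (auto simp: complement_of_def)
  \<comment> \<open>If x in \<open>C\<close> equals d + b, then b = x - d lies both in
    \<open>B\<close> and in the sum of \<open>C\<close> and \<open>D\<close>, so b = 0. Hence x = d
    lies in both \<open>C\<close> and \<open>D\<close>.\<close>
  have "x = \<zero>\<^bsub>M\<^esub>" if x: "x \<in> C" "x \<in> D <+>\<^bsub>M\<^esub> B" for x
  proof -
    obtain d b where db: "d \<in> D" "b \<in> B" "x = d \<oplus>\<^bsub>M\<^esub> b"
      using x by (auto simp: set_add_def')
    have carr: "x \<in> carrier M" "d \<in> carrier M" "b \<in> carrier M"
      using right_submodule_subset B C D x db by auto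
    then have "b = x \<ominus>\<^bsub>M\<^esub> d"
      using db by (simp add: a_minus_def M.a_ac M.r_neg M.r_neg1 M.r_neg2)
    moreover have "x \<ominus>\<^bsub>M\<^esub> d \<in> C <+>\<^bsub>M\<^esub> D"
      using right_submodule_minus[OF right_submodule_set_add[OF C D]] set_add_upper[OF C D] x db
      by blast
    ultimately have "b = \<zero>\<^bsub>M\<^esub>"
      using disj db by blast
    then have "x \<in> D"
      using db carr by simp
    then show ?thesis
      using int x by blast
  qed
  then have "C \<inter> (D <+>\<^bsub>M\<^esub> B) = {\<zero>\<^bsub>M\<^esub>}"
    using right_submodule_zero_mem[OF C] right_submodule_zero_mem right_submodule_set_add[OF D B]
    by blast
  \<comment> \<open>The enlarged submodule contains \<open>D\<close> and still meets
    \<open>C\<close> trivially, so maximality of \<open>D\<close> absorbs \<open>B\<close>.\<close>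
  then have "D <+>\<^bsub>M\<^esub> B = D"
    using CD right_submodule_set_add[OF D B] set_add_upper[OF D B]
    by (auto simp: complement_of_def)
  then have "B \<subseteq> C <+>\<^bsub>M\<^esub> D"
    using set_add_upper[OF D B] set_add_upper[OF C D] by blast
  then show ?thesis
    using disj by blast
qed

text \<open>This is the modular law in elements: let \<open>B\<close> contain \<open>D\<close> and
  meet \<open>C\<close> trivially. Writing x in \<open>B\<close> as c + d puts c = x - d into
  \<open>B\<close>, so c = 0 and x = d.\<close>

lemma direct_summand_complement:
  assumes C: "right_submodule R M C" and D: "right_submodule R M D"
    and sum: "internal_direct_sum M C D (carrier M)"
  shows "complement_of R M C D"
proof -
  have "x \<in> D" if B: "right_submodule R M B" "C \<inter> B = {\<zero>\<^bsub>M\<^esub>}" "D \<subseteq> B" and x: "x \<in> B" for B x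
  proof -
    have "x \<in> C <+>\<^bsub>M\<^esub> D"
      using right_submodule_subset[OF B(1)] x sum by (auto simp: internal_direct_sum_def)
    then obtain c d where cd: "c \<in> C" "d \<in> D" "x = c \<oplus>\<^bsub>M\<^esub> d"
      by (auto simp: set_add_def')
    have carr: "c \<in> carrier M" "d \<in> carrier M"
      using right_submodule_subset C D cd by auto
    have "c = x \<ominus>\<^bsub>M\<^esub> d"
      using cd carr by (simp add: a_minus_def M.a_assoc M.r_neg)
    then have "c \<in> B"
      using right_submodule_minus[OF B(1) x, of d] cd B(3) by blast
    then have "c = \<zero>\<^bsub>M\<^esub>"
      using cd B(2) by blast
    then show ?thesis
      using cd carr by simp
  qed
  then show ?thesis
    using C D sum by (auto simp: complement_of_def internal_direct_sum_def)
qed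

lemma direct_sum_carrier_iff:
  assumes "right_submodule R M C" "right_submodule R M D"
  shows "internal_direct_sum M C D (carrier M) \<longleftrightarrow>
    complement_of R M C D \<and> (\<exists>S. internal_direct_sum M C D S \<and> closed_submodule R M S)"
    (is "?L \<longleftrightarrow> ?R")
proof
  assume ?L
  \<comment> \<open>The whole module is the complement of zero, so it can serve as the witness
    \<open>S\<close>.\<close>
  moreover have "closed_submodule R M (carrier M)"
    using complement_of_zero_iff right_submodule_zero by (auto simp: closed_submodule_def)
  ultimately show ?R
    using direct_summand_complement assms by blast
next
  assume ?R
  then obtain B where CD: "complement_of R M C D"
    and B: "complement_of R M B (C <+>\<^bsub>M\<^esub> D)"
    by (auto simp: internal_direct_sum_def closed_submodule_def)
  have "B = {\<zero>\<^bsub>M\<^esub>}"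
    by (rule complement_set_add_essential[OF CD]) (use B in \<open>simp_all add: complement_of_def\<close>)
  \<comment> \<open>With \<open>B\<close> equal to zero, the sum is a complement of zero.\<close>
  then have "C <+>\<^bsub>M\<^esub> D = carrier M"
    using B complement_of_zero_iff by simp
  then show ?L
    using CD by (simp add: internal_direct_sum_def complement_of_def)
qed

end

theorem theorem4p10:
  fixes R :: "('a, 'r) ring_scheme" and n :: nat and C D :: "(nat \<Rightarrow> 'a) set"
  assumes "finite_frobenius_ring R"
    and "n \<ge> 1"
    and "linear_code R n C"
    and "linear_code R n D"
  shows "LCP R n C D \<longleftrightarrow>
    complement_of R (power_rmod R n) C D \<and>
    (\<exists>S. internal_direct_sum (power_rmod R n) C D S \<and> closed_submodule R (power_rmod R n) S)"
proof -
  \<comment> \<open>The Frobenius hypothesis supplies the ring axioms, so the module results can be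
    read in R^n, where \<open>LCP\<close> says that the direct sum is the whole carrier.\<close>
  interpret right_module R "power_rmod R n"
    using assms(1) by (auto simp: finite_frobenius_ring_def intro: right_module_power_rmod)
  show ?thesis
    using direct_sum_carrier_iff assms(3,4) by (simp add: LCP_def linear_code_def)
qed

end
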